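(* For $k\geq 2$ and $0\le j\le k-1$, $B_{k,j}$ is nonzero if $j\neq 0$ and $k$ and $j$ do not have the same parity. Moreover the $B_{k,j}$ satisfy \[ B_{2,1}=2,\qquad B_{3,2}=2,\qquad B_{k,j}=B_{k-2,j-2}-\left(\frac{k-3}{2}\right)^2B_{k-2,j}\quad (k\geq 4), \] and in particular $B_{k,k-1}=2$ for all $k\ge 2$.
   Context: The Stirling numbers of the first kind $s_{n,m}$ ($n\ge 1$, $0\le m\le n$) are defined by $x(x+1)\cdots(x+n-1)=\sum_{m=0}^{n}(-1)^{n+m}s_{n,m}x^m$. For integers $k\ge 2$ and $0\le j\le k-1$, \[ B_{k,j}=\sum_{p=0}^{k-j-1}(-1)^{k+j+1}\binom{j+p}{j}\left(\frac{k-1}{2}\right)^p\left(s_{k,j+p+1}+s_{k-1,j+p}\right), \] and $B_{k,j}:=0$ for integers $j<0$ or $j\ge k$. *)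

theory Defs
  imports Complex_Main "HOL-Computational_Algebra.Polynomial"
begin

text \<open>Signed Stirling numbers of the first kind: the polynomial \<open>X(X+1)\<cdots>(X+n-1)\<close> is
  \<open>pochhammer [:0, 1:] n\<close>, and \<open>s\<^sub>n\<^sub>,\<^sub>m\<close> is its \<open>m\<close>-th coefficient up to the sign \<open>(-1)\<^sup>n\<^sup>+\<^sup>m\<close>. The lemma
  \<open>stirling1_expansion\<close> below is the defining identity.\<close>

definition stirling1 :: "nat \<Rightarrow> nat \<Rightarrow> int" where
  "stirling1 n m = (-1) ^ (n + m) * coeff (pochhammer [:0, 1:] n) m"

lemma stirling1_expansion:
  fixes n :: nat
  shows "pochhammer [:0, 1:] n = (\<Sum>m=0..n. monom ((-1) ^ (n + m) * stirling1 n m) m)"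
proof -
  have deg: "degree (pochhammer [:0, 1 :: int:] n) \<le> n"
  proof (induction n)
    case 0
    then show ?case by simp
  next
    case (Suc n)
    have "degree ([:0, 1:] + of_nat n :: int poly) \<le> 1"
      by (simp add: of_nat_poly)
    then show ?case
      using Suc degree_mult_le[of "pochhammer [:0, 1 :: int:] n" "[:0, 1:] + of_nat n"]
      by (simp add: pochhammer_Suc)
  qed
  have sign: "(-1) ^ (n + m) * ((-1) ^ (n + m) * c) = (c :: int)" for m c
    by (simp flip: mult.assoc power_mult_distrib)
  show ?thesis
    using poly_as_sum_of_monoms'[OF deg]
    by (simp add: stirling1_def sign atLeast0AtMost)
qed

text \<open>The index \<open>j\<close> is an integer so that the convention \<open>B\<^sub>k\<^sub>,\<^sub>j = 0\<close> for \<open>j < 0\<close> can be expressed.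
  Only \<open>k \<ge> 2\<close> is meaningful.\<close>

definition B :: "nat \<Rightarrow> int \<Rightarrow> real" where
  "B k j =
    (if 0 \<le> j \<and> j < int k then
       (let i = nat j in
        \<Sum>p=0..k - i - 1. (-1) ^ (k + i + 1) * of_nat ((i + p) choose i)
          * ((real k - 1) / 2) ^ p
          * of_int (stirling1 k (i + p + 1) + stirling1 (k - 1) (i + p)))
     else 0)"

end

theory Submission
  imports Defs
begin

text \<open>The signs cancel, and \<open>B\<^sub>k\<^sub>,\<^sub>j\<close> is a Taylor coefficient, namely the coefficient of \<open>y\<^sup>j\<close> in
  \<open>R(y - (k-1)/2)\<close>, where
  \<open>R(x) = (x+1)\<cdots>(x+k-1) + x(x+1)\<cdots>(x+k-2) = (x+1)\<cdots>(x+k-2)(2x+k-1)\<close>.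
  The shift makes the roots symmetric about \<open>0\<close>: the shifted polynomial is \<open>2y\<close> times the product of
  the \<open>y - r\<close> for \<open>r = -(k-3)/2, -(k-5)/2, \<dots>, (k-3)/2\<close>. Splitting off the outermost pair of roots
  gives the recurrence. The nonvanishing holds because the two terms of the recurrence never have
  opposite signs.\<close>

declare add_2_eq_Suc' [simp del]

section \<open>\<open>B\<close> as coefficients of a shifted polynomial\<close>

lemma pcompose_monom: "pcompose (monom a n) q = smult a (q ^ n)"
  for q :: "'a::comm_semiring_1 poly"
  by (induction n) (simp_all add: monom_0 monom_Suc pcompose_pCons)

text \<open>Expand each power of y + c by the binomial theorem. The degree is only bounded by
  \<open>d\<close>, so that the range of summation can be the one in \<open>B\<close>.\<close>

lemma coeff_pcompose_shift:
  fixes q :: "'a::comm_ring_1 poly"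
  assumes "degree q \<le> d" "j \<le> d"
  shows "coeff (pcompose q [:c, 1:]) j = (\<Sum>p=0..d - j. of_nat ((j + p) choose j) * c ^ p * coeff q (j + p))"
proof -
  have "pcompose q [:c, 1:] = pcompose (\<Sum>m\<le>d. monom (coeff q m) m) [:c, 1:]"
    by (simp only: poly_as_sum_of_monoms'[OF assms(1)])
  then have "coeff (pcompose q [:c, 1:]) j = (\<Sum>m\<le>d. coeff q m * coeff ([:c, 1:] ^ m) j)"
    by (simp add: pcompose_sum pcompose_monom coeff_sum)
  also have "\<dots> = (\<Sum>m=j..d. coeff q m * coeff ([:c, 1:] ^ m) j)"
  proof (rule sum.mono_neutral_right)
    show "\<forall>m\<in>{..d} - {j..d}. coeff q m * coeff ([:c, 1:] ^ m) j = 0"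
    proof
      fix m assume "m \<in> {..d} - {j..d}"
      then have "degree ([:c, 1:] ^ m) < j"
        using degree_power_le[of "[:c, 1:]" m] by auto
      then show "coeff q m * coeff ([:c, 1:] ^ m) j = 0"
        by (simp add: coeff_eq_0)
    qed
  qed auto
  also have "\<dots> = (\<Sum>m=j..d. coeff q m * (of_nat (m choose j) * c ^ (m - j)))"
    by (intro sum.cong refl) (simp add: coeff_linear_poly_power)
  also have "\<dots> = (\<Sum>p=0..d - j. coeff q (j + p) * (of_nat ((j + p) choose j) * c ^ p))"
    by (rule sum.reindex_bij_witness[where i = "\<lambda>p. j + p" and j = "\<lambda>m. m - j"])
      (use assms(2) in auto)
  finally show ?thesis
    by (simp add: mult_ac)
qed

text \<open>The Stirling numbers come from an integer polynomial, whereas the shift by (k-1)/2 needs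
  real coefficients.\<close>

lemma of_int_coeff_pochhammer:
  "of_int (coeff (pochhammer [:0, 1:] n) m) = coeff (pochhammer [:0, 1 :: real:] n) m"
proof (induction n arbitrary: m)
  case 0
  then show ?case by (cases m) (simp_all add: one_pCons)
next
  case (Suc n)
  then show ?case
    by (cases m) (simp_all add: pochhammer_Suc of_nat_poly coeff_pCons mult.commute[of "pochhammer _ _"])
qed

text \<open>The shifted polynomial for k = n + 2, an index that avoids truncated
  subtraction.\<close>

definition symmetric_poly :: "nat \<Rightarrow> real poly" where
  "symmetric_poly n = [:0, 2:] * (\<Prod>i<n. [:real i - (real n - 1) / 2, 1:])"

text \<open>Up to sign, the two Stirling terms are coefficients of X(X+1)...(X+n+1) divided by X,
  and of X(X+1)...(X+n). Both contain (X+1)...(X+n); the cofactors X+n+1 and X add up to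
  2X+n+1.\<close>

lemma B_eq_coeff_nat:
  assumes "j \<le> n + 1"
  shows "B (n + 2) (int j) = coeff (symmetric_poly n) j"
proof -
  \<comment> \<open>The centre of the roots -1, ..., -n of \<open>R\<close>, and itself the
    remaining root.\<close>
  define c where "c = - ((real n + 1) / 2)"
  define R where "R = pochhammer [:1, 1 :: real:] n * [:real n + 1, 2:]"
  have coeff_R: "coeff R m = of_int (coeff (pochhammer [:0, 1:] (n + 2)) (m + 1))
      + of_int (coeff (pochhammer [:0, 1:] (n + 1)) m)" for m
  proof -
    have X1: "[:0, 1:] + 1 = [:1, 1 :: real:]"
      by (simp add: one_pCons)
    have "pochhammer [:0, 1 :: real:] (n + 2) = pCons 0 (pochhammer [:1, 1:] n * [:real n + 1, 1:])"
      using pochhammer_rec[of "[:0, 1 :: real:]" "n + 1"] pochhammer_Suc[of "[:1, 1 :: real:]" n]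
      by (simp only: X1) (simp add: add_2_eq_Suc' of_nat_poly add.commute del: mult_pCons_right)
    moreover have "pochhammer [:0, 1 :: real:] (n + 1) = pochhammer [:1, 1:] n * [:0, 1:]"
      using pochhammer_rec[of "[:0, 1 :: real:]" n] by (simp add: X1 mult.commute)
    moreover have "[:real n + 1, 2:] = [:real n + 1, 1:] + [:0, 1:]"
      by simp
    ultimately show ?thesis
      unfolding of_int_coeff_pochhammer R_def by (simp only: distrib_left coeff_add) simp
  qed
  have prod: "pochhammer [:1, 1 :: real:] n = (\<Prod>i<n. [:1 + real i, 1:])"
    by (simp add: pochhammer_prod of_nat_poly atLeast0LessThan)
  have "degree (\<Prod>i<n. [:1 + real i, 1:]) \<le> n"
    using degree_prod_sum_le[of "{..<n}" "\<lambda>i. [:1 + real i, 1:]"] by (simp add: o_def)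
  then have deg: "degree R \<le> n + 1"
    using degree_mult_le[of "pochhammer [:1, 1 :: real:] n" "[:real n + 1, 2:]"]
    by (simp add: R_def prod del: mult_pCons_right)
  have "pcompose R [:c, 1:] = symmetric_poly n"
  proof -
    have "pcompose [:1 + real i, 1:] [:c, 1:] = [:real i - (real n - 1) / 2, 1:]" for i
      by (simp add: pcompose_pCons c_def field_simps)
    moreover have "pcompose [:real n + 1, 2:] [:c, 1:] = [:0, 2:]"
      by (simp add: pcompose_pCons c_def field_simps)
    ultimately show ?thesis
      unfolding R_def prod symmetric_poly_def pcompose_mult pcompose_prod by (simp only: mult.commute)
  qed
  then have "coeff (symmetric_poly n) j
      = (\<Sum>p=0..n + 1 - j. of_nat ((j + p) choose j) * c ^ p * coeff R (j + p))"
    using coeff_pcompose_shift[OF deg assms, of c] by simp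
  also have "\<dots> = B (n + 2) (int j)"
  proof -
    \<comment> \<open>Both Stirling numbers carry the same sign. Together with the sign in
      \<open>B\<close> it leaves (-1)^p, which turns the power of (k-1)/2 into
      \<open>c ^ p\<close>.\<close>
    have summand: "(-1) ^ (n + 2 + j + 1) * of_nat ((j + p) choose j) * ((real (n + 2) - 1) / 2) ^ p
          * of_int (stirling1 (n + 2) (j + p + 1) + stirling1 (n + 2 - 1) (j + p))
        = of_nat ((j + p) choose j) * c ^ p * coeff R (j + p)" for p
    proof -
      have c: "c ^ p = (-1) ^ p * ((real (n + 2) - 1) / 2) ^ p"
        unfolding c_def by (subst power_minus) (simp add: add.commute)
      have s: "of_int (stirling1 (n + 2) (j + p + 1) + stirling1 (n + 2 - 1) (j + p))
          = (-1) ^ (n + j + p + 1) * coeff R (j + p)"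
        by (simp add: stirling1_def coeff_R distrib_left power_add)
      have sq: "(-1 :: real) ^ (n + 2 + j + 1) * (-1) ^ (n + j + p + 1) = (-1) ^ p"
        by (simp add: power_add flip: power_mult_distrib mult.assoc)
          (simp add: mult_ac flip: power_mult_distrib)
      show ?thesis
        unfolding c s sq[symmetric] by (simp only: mult_ac)
    qed
    have "n + 2 - j - 1 = n + 1 - j" "int j < int (n + 2)"
      using assms by auto
    then show ?thesis
      unfolding B_def Let_def nat_int summand by simp
  qed
  finally show ?thesis
    by simp
qed

section \<open>Splitting off the outermost roots, and the recurrence\<close>

lemma symmetric_poly_0: "symmetric_poly 0 = [:0, 2:]"
  by (simp add: symmetric_poly_def)

lemma symmetric_poly_1: "symmetric_poly 1 = [:0, 0, 2:]"
  by (simp add: symmetric_poly_def)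

lemma symmetric_poly_step:
  "symmetric_poly (n + 2) = [:- (((real n + 1) / 2)\<^sup>2), 0, 1:] * symmetric_poly n"
proof -
  define h where "h = (real n + 1) / 2"
  have "(\<Prod>i<n + 2. [:real i - (real (n + 2) - 1) / 2, 1:])
      = [:- h, 1:] * [:h, 1:] * (\<Prod>i<n. [:real i - (real n - 1) / 2, 1:])"
  proof -
    \<comment> \<open>From n to n + 2 the centre of the indices moves by one, so the old factors
      reappear at indices 1 to n; the new ones sit at 0 and n + 1.\<close>
    have "[:real (Suc i) - (real (n + 2) - 1) / 2, 1:] = [:real i - (real n - 1) / 2, 1:]" for i
      by (simp add: field_simps)
    then have "(\<Prod>i<Suc n. [:real (Suc i) - (real (n + 2) - 1) / 2, 1:])
        = (\<Prod>i<Suc n. [:real i - (real n - 1) / 2, 1:])"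
      by (simp only:)
    also have "\<dots> = (\<Prod>i<n. [:real i - (real n - 1) / 2, 1:]) * [:h, 1:]"
      unfolding prod.lessThan_Suc by (simp add: h_def field_simps del: mult_pCons_right)
    moreover have "[:real 0 - (real (n + 2) - 1) / 2, 1:] = [:- h, 1:]"
      by (simp add: h_def)
    ultimately show ?thesis
      using prod.lessThan_Suc_shift[of "\<lambda>i. [:real i - (real (n + 2) - 1) / 2, 1:]" "Suc n"]
      by (simp only: add_2_eq_Suc' mult_ac)
  qed
  moreover have "[:- h, 1:] * [:h, 1:] = [:- (h\<^sup>2), 0, 1:]"
    by (simp add: power2_eq_square)
  ultimately show ?thesis
    unfolding symmetric_poly_def h_def[symmetric] by (simp only: mult.left_commute)
qed

lemma degree_symmetric_poly: "degree (symmetric_poly n) \<le> n + 1"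
proof -
  have "degree (\<Prod>i<n. [:real i - (real n - 1) / 2, 1:]) \<le> n"
    using degree_prod_sum_le[of "{..<n}" "\<lambda>i. [:real i - (real n - 1) / 2, 1:]"] by (simp add: o_def)
  then show ?thesis
    using degree_mult_le[of "[:0, 2 :: real:]" "\<Prod>i<n. [:real i - (real n - 1) / 2, 1:]"]
    unfolding symmetric_poly_def by (simp del: mult_pCons_right mult_pCons_left)
qed

text \<open>For j >= k the convention for \<open>B\<close> agrees with the vanishing of coefficients
  beyond the degree, so only negative \<open>j\<close> stays special.\<close>

lemma B_eq_coeff:
  "B (n + 2) j = (if 0 \<le> j then coeff (symmetric_poly n) (nat j) else 0)"
proof (cases "0 \<le> j \<and> j < int (n + 2)")
  case True
  then have "nat j \<le> n + 1" by linarith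
  then show ?thesis
    using B_eq_coeff_nat[of "nat j" n] True by simp
next
  case False
  then show ?thesis
    using coeff_eq_0[of "symmetric_poly n" "nat j"] degree_symmetric_poly[of n]
    by (auto simp: B_def)
qed

lemma B_recurrence:
  "B (n + 4) j = B (n + 2) (j - 2) - ((real n + 1) / 2)\<^sup>2 * B (n + 2) j"
proof -
  define h where "h = ((real n + 1) / 2)\<^sup>2"
  have step: "symmetric_poly (n + 2) = pCons 0 (pCons 0 (symmetric_poly n)) - smult h (symmetric_poly n)"
    unfolding symmetric_poly_step h_def[symmetric] by simp
  have "B (n + 4) j = (if 0 \<le> j then coeff (symmetric_poly (n + 2)) (nat j) else 0)"
    using B_eq_coeff[of "n + 2" j] by (simp add: add.assoc)
  also have "\<dots> = B (n + 2) (j - 2) - h * B (n + 2) j"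
  proof (cases "0 \<le> j")
    case True
    then obtain i where i: "j = int i" by (rule nonneg_int_cases)
    \<comment> \<open>For i < 2 the factor y^2 contributes nothing, in accordance with
      \<open>B\<close> at the negative index \<open>j - 2\<close>.\<close>
    consider "i = 0" | "i = 1" | i' where "i = i' + 2"
      by (metis One_nat_def add_2_eq_Suc' not0_implies_Suc)
    then show ?thesis
      unfolding B_eq_coeff step i by cases (simp_all add: add_2_eq_Suc' nat_add_distrib)
  qed (simp add: B_eq_coeff)
  finally show ?thesis
    by (simp add: h_def)
qed

section \<open>Special values, signs and the top coefficient\<close>

lemma B_zero: "B (n + 2) 0 = 0"
  by (simp add: B_eq_coeff symmetric_poly_def)

lemma B_2: "B 2 j = (if j = 1 then 2 else 0)"
  using B_eq_coeff[of 0 j] by (auto simp: symmetric_poly_0 coeff_pCons split: nat.splits)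

lemma B_3: "B 3 j = (if j = 2 then 2 else 0)"
  using B_eq_coeff[of 1 j] by (auto simp: symmetric_poly_1[simplified] coeff_pCons split: nat.splits)

text \<open>Nonvanishing is strengthened to a sign so that induction works: in the recurrence the
  first term keeps \<open>m\<close>, the second lowers it by one and has a minus sign. Hence no
  cancellation occurs.\<close>

lemma B_sign:
  assumes "n + 1 = j + 2 * m" "0 < j"
  shows "0 < (-1) ^ m * B (n + 2) (int j)"
  using assms
proof (induction n arbitrary: j m rule: less_induct)
  case (less n)
  consider "n = 0" | "n = 1" | n' where "n = n' + 2"
    by (metis One_nat_def add_2_eq_Suc' not0_implies_Suc)
  then show ?case
  proof cases
    case 1
    with less.prems have "j = 1" "m = 0" by auto
    then show ?thesis using 1 B_2 by simp
  next
    case 2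
    with less.prems have "j = 2" "m = 0" by presburger+
    then show ?thesis using 2 B_3 by (simp add: numeral_3_eq_3)
  next
    case 3
    define h where "h = ((real n' + 1) / 2)\<^sup>2"
    have h: "h > 0" by (simp add: h_def)
    have rec: "(-1) ^ m * B (n + 2) (int j)
        = (-1) ^ m * B (n' + 2) (int j - 2) + h * (- ((-1) ^ m) * B (n' + 2) (int j))"
      using B_recurrence[of n' "int j"] 3 by (simp add: h_def add.commute right_diff_distrib)
    have left: "0 < (-1) ^ m * B (n' + 2) (int j - 2)" if "j > 2"
      using less.IH[of n' "j - 2" m] less.prems 3 that by (simp add: of_nat_diff)
    \<comment> \<open>For j = 2 this is the constant coefficient, for j = 1 the index is
      negative.\<close>
    have left0: "B (n' + 2) (int j - 2) = 0" if "j \<le> 2"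
      using that less.prems(2) B_zero[of n'] by (cases "j = 2") (auto simp: B_def)
    have right: "0 < - ((-1) ^ m) * B (n' + 2) (int j)" if "m > 0"
      using less.IH[of n' j "m - 1"] less.prems 3 that by (cases m) auto
    \<comment> \<open>Here j = n' + 3 lies above the range of indices.\<close>
    have right0: "B (n' + 2) (int j) = 0" if "m = 0"
      using that less.prems 3 by (simp add: B_def)
    show ?thesis
    proof (cases "j > 2")
      case True
      then show ?thesis
        using left right0 mult_pos_pos[OF h right] unfolding rec
        by (cases "m = 0") simp_all
    next
      case False
      \<comment> \<open>At least one term survives: n >= 2 and j <= 2 exclude m = 0.\<close>
      then have "m > 0" using less.prems 3 by presburger
      then show ?thesis
        using mult_pos_pos[OF h right] left0 False unfolding rec by simp
    qed
  qed
qed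

lemma B_nonzero:
  assumes "2 \<le> k" "0 < j" "j \<le> int k - 1" "even (int k) \<noteq> even j"
  shows "B k j \<noteq> 0"
proof -
  have "even (int k - 1 - j)" using assms(4) by auto
  then obtain m where m: "int k - 1 - j = 2 * m" by (elim evenE)
  then have "k - 2 + 1 = nat j + 2 * nat m" using assms by linarith
  then have "0 < (-1) ^ nat m * B (k - 2 + 2) (int (nat j))"
    by (rule B_sign) (use assms in simp)
  then show ?thesis using assms by auto
qed

text \<open>At the top index the second term of the recurrence is out of range, so the value 2 is
  inherited from k = 2 and k = 3.\<close>

lemma B_top: "B (n + 2) (int n + 1) = 2"
proof (induction n rule: less_induct)
  case (less n)
  consider "n = 0" | "n = 1" | n' where "n = n' + 2"
    by (metis One_nat_def add_2_eq_Suc' not0_implies_Suc)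
  then show ?case
  proof cases
    case 1
    then show ?thesis using B_2 by simp
  next
    case 2
    then show ?thesis using B_3 by (simp add: numeral_3_eq_3)
  next
    case 3
    then have "B (n' + 2) (int n + 1) = 0" by (simp add: B_def)
    then show ?thesis
      using B_recurrence[of n' "int n + 1"] less.IH[of n'] 3 by (simp add: add.commute)
  qed
qed

theorem theorem5:
  "(\<forall>(k::nat) (j::int). 2 \<le> k \<and> 0 \<le> j \<and> j \<le> int k - 1 \<longrightarrow>
       j \<noteq> 0 \<and> even (int k) \<noteq> even j \<longrightarrow> B k j \<noteq> 0)
   \<and> B 2 1 = 2
   \<and> B 3 2 = 2
   \<and> (\<forall>(k::nat) (j::int). 4 \<le> k \<and> 0 \<le> j \<and> j \<le> int k - 1 \<longrightarrow>
       B k j = B (k - 2) (j - 2) - ((real k - 3) / 2)\<^sup>2 * B (k - 2) j)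
   \<and> (\<forall>k::nat. 2 \<le> k \<longrightarrow> B k (int k - 1) = 2)"
proof (intro conjI allI impI; (elim conjE)?)
  fix k :: nat and j :: int
  assume "2 \<le> k" "0 \<le> j" "j \<le> int k - 1" "j \<noteq> 0" "even (int k) \<noteq> even j"
  then show "B k j \<noteq> 0" by (intro B_nonzero) auto
next
  show "B 2 1 = 2" "B 3 2 = 2" by (simp_all add: B_2 B_3)
next
  fix k :: nat and j :: int
  assume "4 \<le> k"
  then obtain n where "k = n + 4" by (metis add.commute le_Suc_ex)
  then show "B k j = B (k - 2) (j - 2) - ((real k - 3) / 2)\<^sup>2 * B (k - 2) j"
    using B_recurrence[of n j] by (simp add: add_2_eq_Suc')
next
  fix k :: nat
  assume "2 \<le> k"
  then obtain n where "k = n + 2" by (metis add.commute le_Suc_ex)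
  then show "B k (int k - 1) = 2"
    using B_top[of n] by (simp add: add.commute)
qed

end
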